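(* Let $\mathcal{M}$ be an NIP structure in a language $\mathcal{L}$, let $k\ge3$ and let $\varphi(x_1,\ldots,x_k;z)$ be an $\mathcal{L}$-formula with $|x_1|=\cdots=|x_k|=d$. Let $\psi(x_1,\ldots,x_{k-1};z')$ be the formula $\varphi(x_1,\ldots,x_{k-1};x_k,z)$, that is, $\varphi$ with its variables repartitioned so that $z'=(x_k,z)$ is the tuple of parameter variables. Then there is a constant $C=C(\varphi)$ such that for all large enough $n$, setting $m:=R^*_\psi(n-1)$, we have $R^*_\varphi(n)\le2^{Cm\log m}$.
   Context: $\log$ is the logarithm with base $2$. A family $\mathcal{F}$ of subsets of a set $X$ shatters $A\subseteq X$ if every subset of $A$ has the form $A\cap S$ with $S\in\mathcal{F}$; $\mathcal{F}$ is a VC-class if for some $n$ no subset of $X$ of size $n$ is shattered. A structure $\mathcal{M}$ with underlying set $M$ is NIP if for every formula $\theta(x,y)$ (with $x,y$ finite tuples of variables) the family $\{\theta(M,a):a\in M^{|y|}\}$ of subsets of $M^{|x|}$ is a VC-class. For a $k$-ary relation $E\subseteq X^k$ on a set $X$, a finite sequence $(a_i:1\le i\le m)$ in $X$ is $E$-indiscernible if either $E$ holds on all $k$-tuples $(a_{i_1},\ldots,a_{i_k})$ with $1\le i_1<\cdots<i_k\le m$, or $E$ fails on all such $k$-tuples. For a formula $\varphi(x_1,\ldots,x_k;z)$ with $|x_1|=\cdots=|x_k|=d$ and $b\in M^{|z|}$, let $R_{\varphi(x_1,\ldots,x_k;b)}(n)$ be the smallest $N\in\mathbb{N}$ such that every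 sequence of length $N$ of elements of $M^d$ contains a subsequence of length $n$ that is indiscernible for the $k$-ary relation on $M^d$ defined by $\varphi(x_1,\ldots,x_k;b)$. Then $R^*_\varphi(n):=\max\{R_{\varphi(x_1,\ldots,x_k;b)}(n): b\in M^{|z|}\}$. *)

theory Defs
  imports Complex_Main "HOL-Library.NList" "HOL-Library.Sublist"
begin

section \<open>First-order languages, formulas and structures\<close>

text \<open>The symbols of a language are the elements of the domains of the two partial arity maps, so
  that a language may have no function symbols or no relation symbols.\<close>

record ('f, 'r) language =
  fun_arity :: "'f \<rightharpoonup> nat"
  rel_arity :: "'r \<rightharpoonup> nat"

datatype 'f tm = Var nat | App 'f "'f tm list"

datatype ('f, 'r) fm =
    Eq "'f tm" "'f tm"
  | Rel 'r "'f tm list"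
  | Neg "('f, 'r) fm"
  | Conj "('f, 'r) fm" "('f, 'r) fm"
  | Ex nat "('f, 'r) fm"

fun wf_tm :: "('f, 'r) language \<Rightarrow> 'f tm \<Rightarrow> bool" where
  "wf_tm L (Var v) \<longleftrightarrow> True"
| "wf_tm L (App f ts) \<longleftrightarrow> fun_arity L f = Some (length ts) \<and> (\<forall>t\<in>set ts. wf_tm L t)"

fun wf_fm :: "('f, 'r) language \<Rightarrow> ('f, 'r) fm \<Rightarrow> bool" where
  "wf_fm L (Eq s t) \<longleftrightarrow> wf_tm L s \<and> wf_tm L t"
| "wf_fm L (Rel r ts) \<longleftrightarrow> rel_arity L r = Some (length ts) \<and> (\<forall>t\<in>set ts. wf_tm L t)"
| "wf_fm L (Neg \<phi>) \<longleftrightarrow> wf_fm L \<phi>"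
| "wf_fm L (Conj \<phi> \<psi>) \<longleftrightarrow> wf_fm L \<phi> \<and> wf_fm L \<psi>"
| "wf_fm L (Ex v \<phi>) \<longleftrightarrow> wf_fm L \<phi>"

fun vars_tm :: "'f tm \<Rightarrow> nat set" where
  "vars_tm (Var v) = {v}"
| "vars_tm (App f ts) = (\<Union>t\<in>set ts. vars_tm t)"

fun free_vars :: "('f, 'r) fm \<Rightarrow> nat set" where
  "free_vars (Eq s t) = vars_tm s \<union> vars_tm t"
| "free_vars (Rel r ts) = (\<Union>t\<in>set ts. vars_tm t)"
| "free_vars (Neg \<phi>) = free_vars \<phi>"
| "free_vars (Conj \<phi> \<psi>) = free_vars \<phi> \<union> free_vars \<psi>"
| "free_vars (Ex v \<phi>) = free_vars \<phi> - {v}"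

text \<open>\<open>formula_in L \<phi> vs\<close>: \<open>\<phi>\<close> is an \<open>L\<close>-formula \<open>\<phi>(vs)\<close>, where \<open>vs\<close> is a tuple of distinct
  variables that need not all occur in \<open>\<phi>\<close>. A partitioned formula \<open>\<phi>(x\<^sub>1,\<dots>,x\<^sub>k; z)\<close> is given by \<open>\<phi>\<close>
  together with the list of variable tuples \<open>[x\<^sub>1,\<dots>,x\<^sub>k]\<close> and the variable tuple \<open>z\<close>.\<close>

definition formula_in :: "('f, 'r) language \<Rightarrow> ('f, 'r) fm \<Rightarrow> nat list \<Rightarrow> bool" where
  "formula_in L \<phi> vs \<longleftrightarrow> wf_fm L \<phi> \<and> distinct vs \<and> free_vars \<phi> \<subseteq> set vs"

record ('f, 'r, 'a) struct =
  carrier :: "'a set"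
  fun_interp :: "'f \<Rightarrow> 'a list \<Rightarrow> 'a"
  rel_interp :: "'r \<Rightarrow> 'a list \<Rightarrow> bool"

text \<open>Interpretations are only relevant on tuples from the carrier. The set of \<open>n\<close>-tuples
  from \<open>M\<close> is \<open>nlists n M\<close>.\<close>

definition is_struct :: "('f, 'r) language \<Rightarrow> ('f, 'r, 'a) struct \<Rightarrow> bool" where
  "is_struct L M \<longleftrightarrow> carrier M \<noteq> {} \<and>
     (\<forall>f n. fun_arity L f = Some n \<longrightarrow>
        (\<forall>as\<in>nlists n (carrier M). fun_interp M f as \<in> carrier M))"

fun eval :: "('f, 'r, 'a) struct \<Rightarrow> (nat \<Rightarrow> 'a) \<Rightarrow> 'f tm \<Rightarrow> 'a" where
  "eval M e (Var v) = e v"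
| "eval M e (App f ts) = fun_interp M f (map (eval M e) ts)"

fun sat :: "('f, 'r, 'a) struct \<Rightarrow> (nat \<Rightarrow> 'a) \<Rightarrow> ('f, 'r) fm \<Rightarrow> bool" where
  "sat M e (Eq s t) \<longleftrightarrow> eval M e s = eval M e t"
| "sat M e (Rel r ts) \<longleftrightarrow> rel_interp M r (map (eval M e) ts)"
| "sat M e (Neg \<phi>) \<longleftrightarrow> \<not> sat M e \<phi>"
| "sat M e (Conj \<phi> \<psi>) \<longleftrightarrow> sat M e \<phi> \<and> sat M e \<psi>"
| "sat M e (Ex v \<phi>) \<longleftrightarrow> (\<exists>a\<in>carrier M. sat M (e(v := a)) \<phi>)"

text \<open>\<open>holds M \<phi> vs as\<close>: \<open>\<phi>\<close> is true in \<open>M\<close> when the variables \<open>vs\<close> take the values \<open>as\<close>. The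
  values of other variables are unspecified; they do not matter if \<open>free_vars \<phi> \<subseteq> set vs\<close>.\<close>

definition holds :: "('f, 'r, 'a) struct \<Rightarrow> ('f, 'r) fm \<Rightarrow> nat list \<Rightarrow> 'a list \<Rightarrow> bool" where
  "holds M \<phi> vs as \<longleftrightarrow> sat M (\<lambda>v. the (map_of (zip vs as) v)) \<phi>"


section \<open>NIP structures\<close>

definition shatters :: "'b set set \<Rightarrow> 'b set \<Rightarrow> bool" where
  "shatters F A \<longleftrightarrow> (\<forall>B. B \<subseteq> A \<longrightarrow> (\<exists>S\<in>F. B = A \<inter> S))"

definition VC_class :: "'b set \<Rightarrow> 'b set set \<Rightarrow> bool" where
  "VC_class X F \<longleftrightarrow> (\<exists>n. \<forall>A. A \<subseteq> X \<and> finite A \<and> card A = n \<longrightarrow> \<not> shatters F A)"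

definition NIP :: "('f, 'r) language \<Rightarrow> ('f, 'r, 'a) struct \<Rightarrow> bool" where
  "NIP L M \<longleftrightarrow> (\<forall>\<theta> x y. formula_in L \<theta> (x @ y) \<longrightarrow>
     VC_class (nlists (length x) (carrier M))
       {{u \<in> nlists (length x) (carrier M). holds M \<theta> (x @ y) (u @ a)} | a.
          a \<in> nlists (length y) (carrier M)})"


section \<open>Indiscernible sequences and Ramsey numbers\<close>

definition indiscernible :: "nat \<Rightarrow> 'b list set \<Rightarrow> 'b list \<Rightarrow> bool" where
  "indiscernible k E s \<longleftrightarrow>
     (\<forall>is. length is = k \<and> sorted_wrt (<) is \<and> set is \<subseteq> {..<length s} \<longrightarrow> map ((!) s) is \<in> E) \<or>
     (\<forall>is. length is = k \<and> sorted_wrt (<) is \<and> set is \<subseteq> {..<length s} \<longrightarrow> map ((!) s) is \<notin> E)"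

definition ramsey_num :: "'b set \<Rightarrow> nat \<Rightarrow> 'b list set \<Rightarrow> nat \<Rightarrow> nat" where
  "ramsey_num X k E n =
     (LEAST N. \<forall>s\<in>nlists N X. \<exists>t. subseq t s \<and> length t = n \<and> indiscernible k E t)"

text \<open>The \<open>k\<close>-ary relation on \<open>M\<^sup>d\<close> defined by \<open>\<phi>(x\<^sub>1,\<dots>,x\<^sub>k; b)\<close>, where \<open>xs = [x\<^sub>1,\<dots>,x\<^sub>k]\<close>.\<close>

definition def_rel ::
  "('f, 'r, 'a) struct \<Rightarrow> nat \<Rightarrow> ('f, 'r) fm \<Rightarrow> nat list list \<Rightarrow> nat list \<Rightarrow> 'a list \<Rightarrow> 'a list list set"
where
  "def_rel M d \<phi> xs z b =
     {us \<in> nlists (length xs) (nlists d (carrier M)). holds M \<phi> (concat xs @ z) (concat us @ b)}"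

text \<open>By Ramsey's theorem the least number in \<^const>\<open>ramsey_num\<close> exists and is bounded in terms of
  \<open>k\<close> and \<open>n\<close> alone, so that the following is a maximum of a finite set.\<close>

definition R_star ::
  "('f, 'r, 'a) struct \<Rightarrow> nat \<Rightarrow> ('f, 'r) fm \<Rightarrow> nat list list \<Rightarrow> nat list \<Rightarrow> nat \<Rightarrow> nat"
where
  "R_star M d \<phi> xs z n =
     Max {ramsey_num (nlists d (carrier M)) (length xs) (def_rel M d \<phi> xs z b) n | b.
            b \<in> nlists (length z) (carrier M)}"

end

theory Submission
  imports Defs
begin

text \<open>
  The proof is the step-down argument of Erdos and Rado, made efficient by counting types with the
  Sauer--Shelah lemma. Put \<open>r = k - 1\<close> and let \<open>E\<close> be the \<open>k\<close>-ary relation defined by \<open>\<phi>(x\<^sub>1,\<dots>,x\<^sub>k; b)\<close>.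
  The link of an element \<open>y\<close> over a set \<open>B\<close> is the \<open>r\<close>-ary relation of all \<open>r\<close>-tuples \<open>u\<close> from \<open>B\<close> such that
  \<open>(u, y)\<close> is in \<open>E\<close>; it records the \<open>\<phi>\<close>-type of \<open>y\<close> over \<open>B\<close>.

  From a long sequence one greedily extracts a subsequence \<open>b\<^sub>1,\<dots>,b\<^sub>m,y\<close> such that all elements after
  \<open>b\<^sub>i\<close> have the same link over \<open>{b\<^sub>1,\<dots>,b\<^sub>i}\<close>: take the first remaining element as the next \<open>b\<^sub>i\<close>, split the
  others by their link over \<open>{b\<^sub>1,\<dots>,b\<^sub>i}\<close>, and continue in a largest class. If there are at most \<open>P\<close> links
  over any set of at most \<open>m\<close> elements, each step divides the length by at most \<open>P + 1\<close>, so that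
  \<open>(P + 1)\<^sup>m\<close> elements suffice (\<open>end_homogeneous_subseq_exists\<close>). On such a subsequence the last
  coordinate of an increasing \<open>k\<close>-tuple does not matter for \<open>E\<close>, so it may be replaced by \<open>y\<close>; and the link of \<open>y\<close>
  is a relation defined by \<open>\<psi>\<close>. As \<open>m = R_star \<psi> (n - 1)\<close>, there is a subsequence of \<open>b\<^sub>1,\<dots>,b\<^sub>m\<close> of
  length \<open>n - 1\<close> that is indiscernible for this link, and appending \<open>y\<close> gives an \<open>E\<close>-indiscernible sequence
  of length \<open>n\<close> (\<open>arrows_Suc\<close>).

  It remains to bound \<open>P\<close>. A link over \<open>B\<close> is determined by the trace, on the at most \<open>m\<^sup>r\<close> flattened
  \<open>r\<close>-tuples from \<open>B\<close>, of a set defined by an instance of \<open>\<phi>(x\<^sub>1,\<dots>,x\<^sub>r; x\<^sub>k, z)\<close>. By NIP these sets form a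
  VC-class, so there are at most \<open>(m\<^sup>r + 1)\<^sup>D\<close> traces for a constant \<open>D\<close> (\<open>NIP_few_links\<close>). Hence
  \<open>P\<close> is polynomial in \<open>m\<close>, and \<open>(P + 1)\<^sup>m\<close> is at most \<open>m\<close> to the power \<open>C m\<close>, which is the claimed bound.
\<close>

section \<open>Traces of a VC-class on a finite set\<close>

text \<open>Splitting off a point \<open>x\<close> of the ground set, the members of \<open>F\<close> are counted by their traces \<open>F0\<close>
  on the other points plus the traces \<open>F1\<close> that arise twice, with and without \<open>x\<close>. A set shattered by \<open>F1\<close>
  stays shattered by \<open>F\<close> after adding \<open>x\<close>, so \<open>F1\<close> satisfies the hypothesis with \<open>D - 1\<close>. The resulting
  recursion is satisfied by \<open>(card A + 1) ^ D\<close>; this crude form of the usual sum of binomial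
  coefficients is easier to handle.\<close>

lemma sauer_shelah_Pow:
  assumes "finite A" and "F \<subseteq> Pow A"
    and "\<And>C. C \<subseteq> A \<Longrightarrow> card C = D \<Longrightarrow> \<not> shatters F C"
  shows "card F \<le> (card A + 1) ^ D"
  using assms
proof (induction A arbitrary: F D rule: finite_induct)
  case empty
  have "card F \<le> card {{} :: 'a set}"
    using empty.prems(1) by (intro card_mono) auto
  then show ?case by simp
next
  case (insert x A)
  show ?case
  proof (cases D)
    case 0
    \<comment> \<open>Every nonempty family shatters the empty set.\<close>
    have "F = {}"
      using insert.prems(2)[of "{}"] 0 by (auto simp: shatters_def)
    then show ?thesis by simp
  next
    case (Suc e)
    define F0 where "F0 = (\<lambda>S. S - {x}) ` F"
    define F1 where "F1 = {S \<in> F. x \<notin> S \<and> insert x S \<in> F}"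
    have finF: "finite F"
      using insert.prems(1) insert.hyps(1) by (meson finite_Pow_iff finite_insert finite_subset)
    have F0: "F0 \<subseteq> Pow A" and F1: "F1 \<subseteq> Pow A"
      using insert.prems(1) by (auto simp: F0_def F1_def)
    have "card F0 \<le> (card A + 1) ^ D"
    proof (rule insert.IH[OF F0], rule notI)
      fix C assume C: "C \<subseteq> A" "card C = D" "shatters F0 C"
      have "shatters F C"
        unfolding shatters_def
      proof (intro allI impI)
        fix B assume "B \<subseteq> C"
        then obtain S where "S \<in> F" "B = C \<inter> (S - {x})"
          using C(3) unfolding shatters_def F0_def by blast
        then show "\<exists>S\<in>F. B = C \<inter> S"
          using C(1) insert.hyps(2) by (intro bexI[of _ S]) auto
      qed
      then show False using insert.prems(2)[of C] C by auto
    qed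
    moreover have "card F1 \<le> (card A + 1) ^ e"
    proof (rule insert.IH[OF F1], rule notI)
      fix C assume C: "C \<subseteq> A" "card C = e" "shatters F1 C"
      have "shatters F (insert x C)"
        unfolding shatters_def
      proof (intro allI impI)
        fix B assume B: "B \<subseteq> insert x C"
        then obtain S where S: "S \<in> F1" "B - {x} = C \<inter> S"
          using C(3) unfolding shatters_def by (metis Diff_subset_conv insert_is_Un)
        have "x \<notin> C" using C(1) insert.hyps(2) by blast
        show "\<exists>S\<in>F. B = insert x C \<inter> S"
        proof (cases "x \<in> B")
          case True
          then have "B = insert x C \<inter> insert x S" using S(2) by blast
          then show ?thesis using S(1) unfolding F1_def by blast
        next
          case False
          then have "B = insert x C \<inter> S" using S by (auto simp: F1_def)
          then show ?thesis using S(1) unfolding F1_def by blast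
        qed
      qed
      moreover have "card (insert x C) = D"
        using C insert.hyps Suc by (metis card_insert_disjoint finite_subset subsetD)
      ultimately show False using insert.prems(2)[of "insert x C"] C by auto
    qed
    moreover have "card F \<le> card F0 + card F1"
    proof -
      \<comment> \<open>Two members of \<open>F\<close> with the same trace differ only in \<open>x\<close>, and the larger one is then
        in \<open>insert x ` F1\<close>.\<close>
      have "inj_on (\<lambda>S. S - {x}) (F - insert x ` F1)"
      proof (rule inj_onI)
        fix S T assume S: "S \<in> F - insert x ` F1" and T: "T \<in> F - insert x ` F1"
          and eq: "S - {x} = T - {x}"
        have *: "U \<notin> F" if "U' \<in> F - insert x ` F1" "x \<in> U'" "U = U' - {x}" for U U'
        proof
          assume "U \<in> F"
          then have "U \<in> F1" "U' = insert x U"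
            using that by (auto simp: F1_def insert_absorb)
          then show False using that(1) by blast
        qed
        show "S = T"
        proof (cases "x \<in> S"; cases "x \<in> T")
          assume "x \<in> S" "x \<in> T" then show ?thesis using eq by blast
        next
          assume "x \<in> S" "x \<notin> T"
          then show ?thesis using *[of S T] S T eq by auto
        next
          assume "x \<notin> S" "x \<in> T"
          then show ?thesis using *[of T S] S T eq by auto
        next
          assume "x \<notin> S" "x \<notin> T" then show ?thesis using eq by blast
        qed
      qed
      then have "card (F - insert x ` F1) \<le> card F0"
        unfolding F0_def using finF by (intro card_inj_on_le) auto
      moreover have "card (insert x ` F1) \<le> card F1"
        using finF by (intro card_image_le) (auto simp: F1_def)
      moreover have "card F \<le> card (F - insert x ` F1) + card (insert x ` F1)"
      proof -
        have "insert x ` F1 \<subseteq> F" by (auto simp: F1_def)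
        then have "F = (F - insert x ` F1) \<union> insert x ` F1" by blast
        then show ?thesis by (metis card_Un_le)
      qed
      ultimately show ?thesis by linarith
    qed
    ultimately have "card F \<le> (card A + 1) ^ D + (card A + 1) ^ e" by linarith
    also have "\<dots> = (card A + 2) * (card A + 1) ^ e" using Suc by simp
    also have "\<dots> \<le> (card A + 2) * (card A + 2) ^ e"
      by (intro mult_left_mono power_mono) auto
    finally show ?thesis using Suc insert.hyps by simp
  qed
qed

lemma sauer_shelah:
  assumes "finite A" and "\<And>C. C \<subseteq> A \<Longrightarrow> card C = D \<Longrightarrow> \<not> shatters F C"
  shows "card ((\<inter>) A ` F) \<le> (card A + 1) ^ D"
proof (rule sauer_shelah_Pow[OF assms(1)], blast, rule notI)
  fix C assume C: "C \<subseteq> A" "card C = D" "shatters ((\<inter>) A ` F) C"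
  have "shatters F C"
    unfolding shatters_def
  proof (intro allI impI)
    fix B assume "B \<subseteq> C"
    then obtain S where "S \<in> F" "B = C \<inter> (A \<inter> S)"
      using C(3) unfolding shatters_def by blast
    then show "\<exists>S\<in>F. B = C \<inter> S" using C(1) by (intro bexI[of _ S]) auto
  qed
  then show False using assms(2) C by blast
qed

section \<open>End-homogeneous sequences\<close>

text \<open>Over \<open>B = X\<close> this is the relation obtained from \<open>E\<close> by turning the last coordinate into a
  parameter; over a finite \<open>B\<close> it is the \<open>E\<close>-type of \<open>y\<close> over \<open>B\<close>.\<close>

definition link :: "nat \<Rightarrow> 'b list set \<Rightarrow> 'b set \<Rightarrow> 'b \<Rightarrow> 'b list set" where
  "link r E B y = {us \<in> nlists r B. us @ [y] \<in> E}"

text \<open>The base set \<open>B\<close> collects the elements that were chosen before \<open>t\<close>; it is empty for the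
  finished sequence and makes the definition inductive along \<open>t\<close>.\<close>

definition end_homogeneous :: "nat \<Rightarrow> 'b list set \<Rightarrow> 'b set \<Rightarrow> 'b list \<Rightarrow> bool" where
  "end_homogeneous r E B t \<longleftrightarrow>
     (\<forall>t1 t2. t = t1 @ t2 \<longrightarrow>
        (\<forall>y\<in>set t2. \<forall>y'\<in>set t2. link r E (B \<union> set t1) y = link r E (B \<union> set t1) y'))"

definition few_links :: "nat \<Rightarrow> 'b list set \<Rightarrow> 'b set \<Rightarrow> nat \<Rightarrow> nat \<Rightarrow> bool" where
  "few_links r E X m P \<longleftrightarrow>
     (\<forall>B. B \<subseteq> X \<and> finite B \<and> card B \<le> m \<longrightarrow> card (link r E B ` X) \<le> P)"

(* As conditional rewrite rules these do not terminate together with nlists_def. *)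
declare nlistsE_length [simp del] nlistsE_set [simp del]

lemma set_mono_subseq: "subseq xs ys \<Longrightarrow> set xs \<subseteq> set ys"
  by (metis set_nths_subset subseq_conv_nths)

lemma nlists_eq: "nlists r B = {xs. set xs \<subseteq> B \<and> length xs = r}"
  unfolding nlists_def by blast

lemma finite_nlists: "finite B \<Longrightarrow> finite (nlists r B)"
  unfolding nlists_eq by (rule finite_lists_length_eq)

lemma card_nlists: "finite B \<Longrightarrow> card (nlists r B) = card B ^ r"
  unfolding nlists_eq by (rule card_lists_length_eq)

lemma finite_links: "finite B \<Longrightarrow> finite (link r E B ` X)"
  by (rule finite_subset[of _ "Pow (nlists r B)"]) (auto simp: link_def finite_nlists)

lemma pigeonhole_filter:
  assumes "card (f ` set xs) \<le> P" and "P > 0" and "P * q \<le> length xs"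
  shows "\<exists>v. q \<le> length (filter (\<lambda>x. f x = v) xs)"
proof (rule ccontr)
  assume "\<not> ?thesis"
  then have less: "length (filter (\<lambda>x. f x = v) xs) < q" for v by (simp add: not_le)
  have "length xs = (\<Sum>v\<in>f ` set xs. count_list (map f xs) v)"
    by (subst sum_count_set) auto
  also have "\<dots> \<le> (\<Sum>v\<in>f ` set xs. q - 1)"
  proof (rule sum_mono)
    fix v
    have "count_list (map f xs) v = length (filter (\<lambda>x. f x = v) xs)"
      by (induction xs) auto
    then show "count_list (map f xs) v \<le> q - 1" using less[of v] by simp
  qed
  also have "\<dots> \<le> P * (q - 1)" using assms(1) by simp
  also have "\<dots> < P * q" using assms(2) less[of undefined] by auto
  finally show False using assms(3) by simp
qed

text \<open>The greedy choice. The next element is the head of \<open>s\<close>; it is added to the base, and among the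
  remaining at least \<open>(P + 1) ^ (j + 1) - 1 \<ge> P * (P + 1) ^ j\<close> elements one of the at most \<open>P\<close> classes of
  equal link over the new base has at least \<open>(P + 1) ^ j\<close> elements. The \<open>+ 1\<close> in the base of the
  power pays for the head.\<close>

lemma end_homogeneous_subseq_exists:
  assumes few: "few_links r E X m P"
  shows "\<lbrakk>B \<subseteq> X; finite B; card B + j \<le> m; set s \<subseteq> X; (P + 1) ^ j \<le> length s;
          \<And>y y'. y \<in> set s \<Longrightarrow> y' \<in> set s \<Longrightarrow> link r E B y = link r E B y'\<rbrakk>
         \<Longrightarrow> \<exists>t. subseq t s \<and> length t = Suc j \<and> end_homogeneous r E B t"
proof (induction j arbitrary: B s)
  case 0
  then obtain x s' where s: "s = x # s'" by (cases s) auto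
  have "end_homogeneous r E B [x]"
    unfolding end_homogeneous_def by (auto simp: Cons_eq_append_conv)
  then show ?case using s by (intro exI[of _ "[x]"]) auto
next
  case (Suc j)
  obtain b s1 where s: "s = b # s1"
    using Suc.prems(5) by (cases s) auto
  let ?f = "link r E (insert b B)"
  have B': "insert b B \<subseteq> X" "finite (insert b B)" "card (insert b B) + j \<le> m"
    using Suc.prems s card_insert_le_m1[of "Suc (card B)" B b] by auto
  have le: "card (?f ` X) \<le> P" using few B' by (simp add: few_links_def)
  \<comment> \<open>There is at least one link, namely that of \<open>b\<close>.\<close>
  have P: "P > 0"
    using le finite_links[OF B'(2), of r E X] Suc.prems(4) s
    by (metis bot_nat_0.not_eq_extremum card_gt_0_iff empty_is_image emptyE le_zero_eq
        list.set_intros(1) subsetD)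
  have "card (?f ` set s1) \<le> P"
    using Suc.prems(4) s finite_links[OF B'(2), of r E X]
    by (intro order.trans[OF card_mono le]) auto
  moreover have "P * (P + 1) ^ j \<le> length s1"
  proof -
    have "(P + 1) ^ Suc j = P * (P + 1) ^ j + (P + 1) ^ j" and "(P + 1) ^ j > 0" by simp_all
    moreover have "(P + 1) ^ Suc j \<le> Suc (length s1)" using Suc.prems(5) s by simp
    ultimately show ?thesis by linarith
  qed
  ultimately obtain v where v: "(P + 1) ^ j \<le> length (filter (\<lambda>x. ?f x = v) s1)"
    using pigeonhole_filter P by metis
  let ?s = "filter (\<lambda>x. ?f x = v) s1"
  obtain t where t: "subseq t ?s" "length t = Suc j" "end_homogeneous r E (insert b B) t"
  proof -
    have "set ?s \<subseteq> X" using Suc.prems(4) s by auto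
    moreover have "?f y = ?f y'" if "y \<in> set ?s" "y' \<in> set ?s" for y y'
      using that by simp
    ultimately show ?thesis using Suc.IH[OF B' _ v] that by blast
  qed
  have sub: "subseq (b # t) s"
    using t(1) s by (auto intro: subseq_order.order_trans[OF _ subseq_filter_left])
  have "end_homogeneous r E B (b # t)"
    unfolding end_homogeneous_def
  proof (intro allI impI ballI)
    fix t1 t2 y y' assume eq: "b # t = t1 @ t2" and y: "y \<in> set t2" "y' \<in> set t2"
    show "link r E (B \<union> set t1) y = link r E (B \<union> set t1) y'"
    proof (cases t1)
      case Nil
      have "set (b # t) \<subseteq> set s" using sub by (rule set_mono_subseq)
      then have "set t2 \<subseteq> set s" using eq Nil by simp
      then have "link r E B y = link r E B y'" using y by (intro Suc.prems(6)) blast+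
      then show ?thesis by (simp add: Nil)
    next
      case (Cons b' t1')
      then have "b' = b" "t = t1' @ t2" using eq by auto
      then have "link r E (insert b B \<union> set t1') y = link r E (insert b B \<union> set t1') y'"
        using t(3) y unfolding end_homogeneous_def by blast
      then show ?thesis using Cons \<open>b' = b\<close> by simp
    qed
  qed
  then show ?case using sub t(2) by (intro exI[of _ "b # t"]) auto
qed

section \<open>Stepping up by one arity\<close>

definition arrows :: "'b set \<Rightarrow> nat \<Rightarrow> 'b list set \<Rightarrow> nat \<Rightarrow> nat \<Rightarrow> bool" where
  "arrows X k E n N \<longleftrightarrow>
     (\<forall>s\<in>nlists N X. \<exists>t. subseq t s \<and> length t = n \<and> indiscernible k E t)"

lemma arrows_mono:
  assumes "arrows X k E n N" and "N \<le> N'"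
  shows "arrows X k E n N'"
  unfolding arrows_def
proof
  fix s assume s: "s \<in> nlists N' X"
  then have "take N s \<in> nlists N X"
    using assms(2) set_take_subset[of N s] by (auto simp: nlists_def dest: in_set_takeD)
  then obtain t where t: "subseq t (take N s)" "length t = n" "indiscernible k E t"
    using assms(1) unfolding arrows_def by blast
  moreover have "subseq t s"
    using subseq_order.order_trans[OF t(1) prefix_imp_subseq[OF take_is_prefix]] .
  ultimately show "\<exists>t. subseq t s \<and> length t = n \<and> indiscernible k E t" by blast
qed

lemma subseq_map_nth:
  "sorted_wrt (<) is \<Longrightarrow> set is \<subseteq> {..<length t} \<Longrightarrow> subseq (map ((!) t) is) t"
proof (induction "is" arbitrary: t rule: rev_induct)
  case Nil
  then show ?case by simp
next
  case (snoc l js)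
  have js: "\<forall>j\<in>set js. j < l" "sorted_wrt (<) js" and l: "l < length t"
    using snoc.prems by (auto simp: sorted_wrt_append)
  have "subseq (map ((!) (take l t)) js) (take l t)"
    using snoc.IH[of "take l t"] js l by auto
  moreover have "map ((!) (take l t)) js = map ((!) t) js" using js by simp
  moreover have "subseq [t ! l] (drop l t)" using l by (simp add: Cons_nth_drop_Suc[symmetric])
  ultimately have "subseq (map ((!) t) js @ [t ! l]) (take l t @ drop l t)"
    by (metis list_emb_append_mono)
  then show ?case by simp
qed

text \<open>In an end-homogeneous sequence the last coordinate of a tuple may be moved to the end: some
  initial segment \<open>t1\<close> contains \<open>us\<close>, while \<open>w\<close> and \<open>y\<close> both come after it.\<close>

lemma end_homogeneous_last:
  assumes "end_homogeneous r E {} (u @ [y])" and "subseq (us @ [w]) (u @ [y])"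
    and "length us = r"
  shows "us @ [w] \<in> E \<longleftrightarrow> us @ [y] \<in> E"
proof -
  obtain t1 t2 where t: "u @ [y] = t1 @ t2" "subseq us t1" "subseq [w] t2"
    using list_emb_appendD[OF assms(2)] by blast
  have w: "w \<in> set t2" using t(3) by (simp add: subseq_singleton_left)
  then have "last (u @ [y]) = last t2" using t(1) by (metis empty_iff empty_set last_appendR)
  then have y: "y \<in> set t2" using w by (metis empty_iff empty_set last_in_set last_snoc)
  have "us \<in> nlists r (set t1)"
    using set_mono_subseq[OF t(2)] assms(3) by (rule nlistsI[rotated])
  moreover have "link r E ({} \<union> set t1) w = link r E ({} \<union> set t1) y"
    using assms(1) t(1) w y unfolding end_homogeneous_def by blast
  ultimately show ?thesis unfolding link_def by auto
qed

text \<open>By \<open>end_homogeneous_last\<close>, whether an increasing \<open>(r + 1)\<close>-tuple from \<open>u' @ [y]\<close> is in \<open>E\<close> only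
  depends on its first \<open>r\<close> entries, which lie in \<open>u'\<close>, and on the link of \<open>y\<close>.\<close>

lemma indiscernible_snoc:
  assumes hom: "end_homogeneous r E {} (u @ [y])" and u': "subseq u' u"
    and ind: "indiscernible r (link r E X y) u'" and X: "set u' \<subseteq> X"
  shows "indiscernible (Suc r) E (u' @ [y])"
proof -
  let ?t = "u' @ [y]"
  have key: "\<exists>js. length js = r \<and> sorted_wrt (<) js \<and> set js \<subseteq> {..<length u'} \<and>
      (map ((!) ?t) is \<in> E \<longleftrightarrow> map ((!) u') js \<in> link r E X y)"
    if "is": "length is = Suc r" "sorted_wrt (<) is" "set is \<subseteq> {..<length ?t}" for "is"
  proof -
    obtain js l where isl: "is = js @ [l]"
      using "is"(1) by (metis length_Suc_conv_rev)
    have js: "length js = r" "sorted_wrt (<) js" "\<forall>j\<in>set js. j < l" "l \<le> length u'"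
      using "is" isl by (auto simp: sorted_wrt_append)
    have jsu: "set js \<subseteq> {..<length u'}" using js by auto
    have "map ((!) ?t) js = map ((!) u') js" using jsu by (auto simp: nth_append)
    then have eq: "map ((!) ?t) is = map ((!) u') js @ [?t ! l]" using isl by simp
    have "subseq (map ((!) ?t) is) ?t" by (rule subseq_map_nth) (use "is" in auto)
    also have "subseq ?t (u @ [y])" using u' by (intro list_emb_append_mono) auto
    finally have "subseq (map ((!) u') js @ [?t ! l]) (u @ [y])" unfolding eq .
    then have "map ((!) u') js @ [?t ! l] \<in> E \<longleftrightarrow> map ((!) u') js @ [y] \<in> E"
      using end_homogeneous_last[OF hom] js(1) by simp
    moreover have "map ((!) u') js \<in> nlists r X"
      using X jsu js(1) nth_mem by (fastforce simp: nlists_def)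
    ultimately have "map ((!) ?t) is \<in> E \<longleftrightarrow> map ((!) u') js \<in> link r E X y"
      unfolding eq link_def by blast
    then show ?thesis using js jsu by blast
  qed
  show ?thesis using ind key unfolding indiscernible_def by meson
qed

text \<open>The step from arity \<open>r\<close> to arity \<open>r + 1\<close>. Positivity of \<open>r\<close> makes all links over the empty base
  equal (there are no \<open>r\<close>-tuples), so that the extraction can start without a first
  splitting.\<close>

lemma arrows_Suc:
  assumes "r > 0" and few: "few_links r E X m P"
    and arr: "\<And>y. y \<in> X \<Longrightarrow> arrows X r (link r E X y) n m"
  shows "arrows X (Suc r) E (Suc n) ((P + 1) ^ m)"
  unfolding arrows_def
proof
  fix s assume s: "s \<in> nlists ((P + 1) ^ m) X"
  have "\<exists>t. subseq t s \<and> length t = Suc m \<and> end_homogeneous r E {} t"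
  proof (rule end_homogeneous_subseq_exists[OF few])
    show "link r E {} y = link r E {} y'" if "y \<in> set s" "y' \<in> set s" for y y'
      using \<open>r > 0\<close> by (auto simp: link_def nlists_def)
  qed (use s in \<open>auto simp: nlists_def\<close>)
  then obtain t where t: "subseq t s" "length t = Suc m" "end_homogeneous r E {} t"
    by blast
  obtain u y where uy: "t = u @ [y]" using t(2) by (metis length_Suc_conv_rev)
  have tX: "set t \<subseteq> X" using set_mono_subseq[OF t(1)] s by (meson nlistsE_set order.trans)
  have "u \<in> nlists m X" "y \<in> X" using uy t(2) tX by (auto simp: nlists_def)
  then obtain u' where u': "subseq u' u" "length u' = n" "indiscernible r (link r E X y) u'"
    using arr unfolding arrows_def by blast
  have "set u' \<subseteq> X" using set_mono_subseq[OF u'(1)] tX uy by auto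
  then have "indiscernible (Suc r) E (u' @ [y])"
    using indiscernible_snoc t(3) u' uy by metis
  moreover have "subseq (u' @ [y]) s"
    using subseq_order.order_trans[OF list_emb_append_mono[OF u'(1) subseq_order.order_refl]] t(1) uy
    by blast
  ultimately show "\<exists>t. subseq t s \<and> length t = Suc n \<and> indiscernible (Suc r) E t"
    using u'(2) by (intro exI[of _ "u' @ [y]"]) auto
qed

text \<open>Ramsey's theorem, with a bound that is uniform in the relation. It comes from the same step,
  now with the trivial bound on the number of links over a set of \<open>m\<close> elements.\<close>

lemma ramsey_sequences:
  assumes "k > 0"
  shows "\<exists>N. \<forall>E. arrows X k E n N"
  using assms
proof (induction k arbitrary: n rule: nat_induct_non_zero)
  case 1
  have "arrows X 1 E n (2 * n)" for E
    unfolding arrows_def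
  proof
    fix s assume s: "s \<in> nlists (2 * n) X"
    have "card ((\<lambda>x. [x] \<in> E) ` set s) \<le> card (UNIV :: bool set)"
      by (intro card_mono) auto
    then obtain v where v: "n \<le> length (filter (\<lambda>x. ([x] \<in> E) = v) s)"
      using pigeonhole_filter[of "\<lambda>x. [x] \<in> E" s 2 n] s by (auto simp: nlists_def)
    define t where "t = take n (filter (\<lambda>x. ([x] \<in> E) = v) s)"
    have "subseq t s"
      unfolding t_def
      by (rule subseq_order.order_trans[OF prefix_imp_subseq[OF take_is_prefix] subseq_filter_left])
    moreover have "length t = n" using v by (simp add: t_def)
    moreover have all: "\<forall>x\<in>set t. ([x] \<in> E) = v"
      unfolding t_def by (auto dest: in_set_takeD)
    have "map ((!) t) is \<in> E \<longleftrightarrow> v" if "length is = 1" "set is \<subseteq> {..<length t}" for "is"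
      using that all by (auto simp: length_Suc_conv)
    then have "indiscernible 1 E t"
      unfolding indiscernible_def by (cases v) blast+
    ultimately show "\<exists>t. subseq t s \<and> length t = n \<and> indiscernible 1 E t" by blast
  qed
  then show ?case by blast
next
  case (Suc k)
  show ?case
  proof (cases n)
    case 0
    have "arrows X (Suc k) E 0 0" for E
      by (auto simp: arrows_def indiscernible_def length_Suc_conv)
    then show ?thesis using 0 by blast
  next
    case (Suc n')
    obtain m where m: "\<forall>E. arrows X k E n' m" using Suc.IH by blast
    have "few_links k E X m (2 ^ m ^ k)" for E
      unfolding few_links_def
    proof (intro allI impI)
      fix B assume B: "B \<subseteq> X \<and> finite B \<and> card B \<le> m"
      have "card (link k E B ` X) \<le> card (Pow (nlists k B))"
        using B by (intro card_mono) (auto simp: link_def finite_nlists)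
      also have "\<dots> = 2 ^ card B ^ k" using B by (simp add: card_Pow finite_nlists card_nlists)
      also have "\<dots> \<le> 2 ^ m ^ k" using B by (intro power_increasing power_mono) auto
      finally show "card (link k E B ` X) \<le> 2 ^ m ^ k" .
    qed
    then show ?thesis using arrows_Suc[OF Suc.hyps] m Suc by blast
  qed
qed

section \<open>The numbers \<open>R_star\<close>\<close>

lemma ramsey_num_le: "arrows X k E n N \<Longrightarrow> ramsey_num X k E n \<le> N"
  unfolding ramsey_num_def arrows_def by (rule Least_le)

lemma arrows_ramsey_num: "arrows X k E n N \<Longrightarrow> arrows X k E n (ramsey_num X k E n)"
  unfolding ramsey_num_def arrows_def by (rule LeastI)

text \<open>The maximum in \<^const>\<open>R_star\<close> is meaningful only for a finite nonempty set. Here finiteness is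
  a consequence of the uniform bound \<open>N\<close>; in \<open>arrows_R_star\<close> it comes from Ramsey's theorem.\<close>

lemma R_star_le:
  assumes "carrier M \<noteq> {}"
    and "\<And>b. b \<in> nlists (length z) (carrier M) \<Longrightarrow>
           arrows (nlists d (carrier M)) (length xs) (def_rel M d \<phi> xs z b) n N"
  shows "R_star M d \<phi> xs z n \<le> N"
proof -
  let ?R = "{ramsey_num (nlists d (carrier M)) (length xs) (def_rel M d \<phi> xs z b) n | b.
            b \<in> nlists (length z) (carrier M)}"
  have "?R \<subseteq> {..N}" using ramsey_num_le assms(2) by blast
  moreover from this have "finite ?R" by (rule finite_subset) simp
  moreover have "?R \<noteq> {}" using nlists_not_empty[OF assms(1)] by blast
  ultimately show ?thesis unfolding R_star_def by (subst Max_le_iff) auto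
qed

lemma arrows_R_star:
  assumes "length xs > 0" and "b \<in> nlists (length z) (carrier M)"
  shows "arrows (nlists d (carrier M)) (length xs) (def_rel M d \<phi> xs z b) n
           (R_star M d \<phi> xs z n)"
proof -
  let ?r = "\<lambda>b. ramsey_num (nlists d (carrier M)) (length xs) (def_rel M d \<phi> xs z b) n"
  let ?R = "{?r b | b. b \<in> nlists (length z) (carrier M)}"
  obtain N where N: "\<forall>E. arrows (nlists d (carrier M)) (length xs) E n N"
    using ramsey_sequences[OF assms(1)] by blast
  have "?R \<subseteq> {..N}" using ramsey_num_le N by blast
  then have "finite ?R" by (rule finite_subset) simp
  then have "?r b \<le> R_star M d \<phi> xs z n"
    unfolding R_star_def using assms(2) by (intro Max_ge) auto
  then show ?thesis using arrows_mono arrows_ramsey_num N by blast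
qed

text \<open>This makes \<open>m\<close> tend to infinity with \<open>n\<close>, so that logarithms of \<open>m\<close> are positive.\<close>

lemma R_star_ge:
  assumes "length xs > 0" and "carrier M \<noteq> {}"
  shows "n \<le> R_star M d \<phi> xs z n"
proof -
  obtain b where b: "b \<in> nlists (length z) (carrier M)"
    using nlists_not_empty[OF assms(2)] by blast
  obtain u where "u \<in> nlists d (carrier M)" using nlists_not_empty[OF assms(2)] by blast
  then obtain s where s: "s \<in> nlists (R_star M d \<phi> xs z n) (nlists d (carrier M))"
    using nlists_not_empty by blast
  then obtain t where "subseq t s" "length t = n"
    using arrows_R_star[OF assms(1) b] unfolding arrows_def by blast
  then show ?thesis using s by (metis list_emb_length nlistsE_length)
qed

section \<open>Links of definable relations\<close>

lemma concat_in_nlists: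
  "us \<in> nlists r (nlists d A) \<Longrightarrow> concat us \<in> nlists (r * d) A"
proof (induction us arbitrary: r)
  case Nil
  then show ?case by (simp add: nlists_def)
next
  case (Cons u us)
  obtain q where q: "r = Suc q" "u \<in> nlists d A" "us \<in> nlists q (nlists d A)"
    using Cons.prems by (rule nlists_Cons_Suc)
  then show ?case using Cons.IH[OF q(3)] by (simp add: nlists_def)
qed

lemma def_rel_snoc:
  assumes "xs \<noteq> []" and "us \<in> nlists (length xs - 1) (nlists d (carrier M))"
    and "y \<in> nlists d (carrier M)"
  shows "us @ [y] \<in> def_rel M d \<phi> xs z b \<longleftrightarrow>
         holds M \<phi> (concat (butlast xs) @ (last xs @ z)) (concat us @ (y @ b))"
proof -
  have "concat xs = concat (butlast xs) @ last xs"
    using assms(1) by (metis append_butlast_last_id concat.simps concat_append append_Nil2)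
  moreover have "us @ [y] \<in> nlists (length xs) (nlists d (carrier M))"
    using assms by (auto simp: nlists_def)
  ultimately show ?thesis by (simp add: def_rel_def)
qed

text \<open>The link of \<open>y\<close> in the relation defined by \<open>\<phi>\<close> with parameter \<open>b\<close> is the relation defined by the
  repartitioned formula with parameter \<open>(y, b)\<close>.\<close>

lemma link_def_rel:
  assumes "xs \<noteq> []" and "y \<in> nlists d (carrier M)"
  shows "link (length xs - 1) (def_rel M d \<phi> xs z b) (nlists d (carrier M)) y =
         def_rel M d \<phi> (butlast xs) (last xs @ z) (y @ b)"
  using def_rel_snoc[OF assms(1) _ assms(2)]
  by (auto simp: link_def def_rel_def[of M d \<phi> "butlast xs"])

text \<open>NIP is applied to \<open>\<phi>\<close> with object variables \<open>x\<^sub>1,\<dots>,x\<^sub>k\<^sub>-\<^sub>1\<close> and parameter variables \<open>x\<^sub>k, z\<close>. The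
  VC-class consists of sets of flat tuples, so a link over \<open>B\<close> is recovered from a trace on the
  set \<open>concat ` nlists (k - 1) B\<close>. The exponent \<open>D\<close> depends neither on \<open>b\<close> nor on \<open>m\<close>, because \<open>z\<close> is
  among the parameter variables.\<close>

lemma NIP_few_links:
  assumes "NIP L M" and xs: "xs \<noteq> []" "\<forall>x\<in>set xs. length x = d"
    and "formula_in L \<phi> (concat xs @ z)"
  shows "\<exists>D. \<forall>b\<in>nlists (length z) (carrier M). \<forall>m.
           few_links (length xs - 1) (def_rel M d \<phi> xs z b) (nlists d (carrier M)) m
             ((m ^ (length xs - 1) + 1) ^ D)"
proof -
  let ?x = "concat (butlast xs)" and ?y = "last xs @ z" and ?r = "length xs - 1"
  let ?X = "nlists d (carrier M)"
  let ?S = "\<lambda>a. {u \<in> nlists (length ?x) (carrier M). holds M \<phi> (?x @ ?y) (u @ a)}"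
  let ?F = "?S ` nlists (length ?y) (carrier M)"
  have split: "concat xs = ?x @ last xs"
    using xs(1) by (metis append_butlast_last_id concat.simps concat_append append_Nil2)
  have "formula_in L \<phi> (?x @ ?y)" using assms(4) split by simp
  then have "VC_class (nlists (length ?x) (carrier M)) ?F"
    using assms(1) unfolding NIP_def Setcompr_eq_image by blast
  then obtain D where D: "\<And>A. A \<subseteq> nlists (length ?x) (carrier M) \<Longrightarrow> finite A \<Longrightarrow>
      card A = D \<Longrightarrow> \<not> shatters ?F A"
    unfolding VC_class_def by blast
  have len_x: "length ?x = ?r * d"
  proof -
    have "\<forall>x\<in>set (butlast xs). length x = d" using xs(2) by (auto dest: in_set_butlastD)
    then have "length (concat (butlast xs)) = length (butlast xs) * d"
      by (induction "butlast xs" rule: rev_induct)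
         (simp_all add: length_concat sum_list_triv cong: map_cong)
    then show ?thesis by simp
  qed
  have "few_links ?r (def_rel M d \<phi> xs z b) ?X m ((m ^ ?r + 1) ^ D)"
    if b: "b \<in> nlists (length z) (carrier M)" for b m
    unfolding few_links_def
  proof (intro allI impI)
    fix B assume "B \<subseteq> ?X \<and> finite B \<and> card B \<le> m"
    then have B: "B \<subseteq> ?X" "finite B" "card B \<le> m" by auto
    let ?A = "concat ` nlists ?r B"
    \<comment> \<open>The link as a function of the trace.\<close>
    let ?g = "\<lambda>T. {us \<in> nlists ?r B. concat us \<in> T}"
    have A: "finite ?A" "?A \<subseteq> nlists (length ?x) (carrier M)"
      using B concat_in_nlists[of _ ?r d "carrier M"] nlists_mono[OF B(1), of ?r] len_x
      by (auto simp: finite_nlists)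
    have cA: "card ?A \<le> m ^ ?r"
      using card_image_le[OF finite_nlists[OF B(2), of ?r], of concat] B
      by (simp add: card_nlists) (meson le_trans power_mono zero_le)
    have "link ?r (def_rel M d \<phi> xs z b) B y \<in> ?g ` (\<inter>) ?A ` ?F" if y: "y \<in> ?X" for y
    proof -
      have "y @ b \<in> nlists (length ?y) (carrier M)"
        using y b xs by (auto simp: nlists_def)
      then have F: "?S (y @ b) \<in> ?F" by (rule imageI)
      have "us @ [y] \<in> def_rel M d \<phi> xs z b \<longleftrightarrow> concat us \<in> ?S (y @ b)"
        if us: "us \<in> nlists ?r B" for us
      proof -
        have "us \<in> nlists ?r ?X" using us nlists_mono[OF B(1)] by blast
        moreover have "concat us \<in> nlists (length ?x) (carrier M)" using us A(2) by blast
        ultimately show ?thesis using def_rel_snoc[OF xs(1) _ y] by simp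
      qed
      then have "link ?r (def_rel M d \<phi> xs z b) B y = ?g (?A \<inter> ?S (y @ b))"
        unfolding link_def by blast
      then show ?thesis using F by blast
    qed
    then have sub: "link ?r (def_rel M d \<phi> xs z b) B ` ?X \<subseteq> ?g ` (\<inter>) ?A ` ?F"
      by (intro image_subsetI)
    have "(\<inter>) ?A ` ?F \<subseteq> Pow ?A" by blast
    then have fin: "finite ((\<inter>) ?A ` ?F)" using A(1) by (meson finite_Pow_iff finite_subset)
    have "card (link ?r (def_rel M d \<phi> xs z b) B ` ?X) \<le> card (?g ` (\<inter>) ?A ` ?F)"
      by (intro card_mono finite_imageI fin sub)
    also have "\<dots> \<le> card ((\<inter>) ?A ` ?F)" by (intro card_image_le fin)
    also have "\<dots> \<le> (card ?A + 1) ^ D"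
    proof (rule sauer_shelah[OF A(1)])
      fix C assume "C \<subseteq> ?A" "card C = D"
      then show "\<not> shatters ?F C"
        by (intro D order.trans[OF _ A(2)] finite_subset[OF _ A(1)])
    qed
    also have "\<dots> \<le> (m ^ ?r + 1) ^ D" using cA by (intro power_mono) auto
    finally show "card (link ?r (def_rel M d \<phi> xs z b) B ` ?X) \<le> (m ^ ?r + 1) ^ D" .
  qed
  then show ?thesis by blast
qed

section \<open>The bound\<close>

lemma step_up_bound_le_power:
  fixes m :: nat
  assumes "m \<ge> 2"
  shows "((m ^ r + 1) ^ D + 1) ^ m \<le> m ^ ((Suc r * D + 1) * m)"
proof -
  have step: "m ^ i + 1 \<le> m ^ Suc i" for i
  proof -
    have "m ^ i + 1 \<le> 2 * m ^ i" using assms by (simp add: Suc_le_eq)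
    also have "\<dots> \<le> m ^ Suc i" using assms by simp
    finally show ?thesis .
  qed
  have "(m ^ r + 1) ^ D \<le> (m ^ Suc r) ^ D" by (rule power_mono[OF step]) simp
  also have "\<dots> = m ^ (Suc r * D)" by (simp only: power_mult)
  finally have "(m ^ r + 1) ^ D + 1 \<le> m ^ (Suc r * D + 1)"
    using step[of "Suc r * D"] by simp
  then show ?thesis unfolding power_mult by (rule power_mono) simp
qed

theorem theorem6p1:
  fixes L :: "('f, 'r) language" and M :: "('f, 'r, 'a) struct"
    and \<phi> :: "('f, 'r) fm" and k d :: nat and xs :: "nat list list" and z :: "nat list"
  assumes "is_struct L M" and "NIP L M"
    and "k \<ge> 3"
    and "length xs = k" and "\<forall>x\<in>set xs. length x = d"
    and "formula_in L \<phi> (concat xs @ z)"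
  shows "\<exists>C::real. \<forall>\<^sub>F n in sequentially.
           (let m = R_star M d \<phi> (butlast xs) (last xs @ z) (n - 1)
            in real (R_star M d \<phi> xs z n) \<le> 2 powr (C * real m * log 2 (real m)))"
proof -
  let ?X = "nlists d (carrier M)"
  have carrier: "carrier M \<noteq> {}" using assms(1) by (simp add: is_struct_def)
  have xs: "xs \<noteq> []" and k: "k - 1 > 0" "Suc (k - 1) = k" "length (butlast xs) = k - 1"
    using assms(3,4) by auto
  obtain D where D: "\<And>b m. b \<in> nlists (length z) (carrier M) \<Longrightarrow>
      few_links (k - 1) (def_rel M d \<phi> xs z b) ?X m ((m ^ (k - 1) + 1) ^ D)"
    using NIP_few_links[OF assms(2) xs assms(5,6)] assms(4) by blast
  \<comment> \<open>The constant \<open>C\<close>: by \<open>step_up_bound_le_power\<close> the bound of \<open>arrows_Suc\<close> is at most \<open>m ^ (e * m)\<close>.\<close>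
  define e where "e = k * D + 1"
  have "real (R_star M d \<phi> xs z n) \<le> 2 powr (real e * real m * log 2 (real m))"
    if n: "n \<ge> 3" and m: "m = R_star M d \<phi> (butlast xs) (last xs @ z) (n - 1)" for n m
  proof -
    have "n - 1 \<le> m"
      unfolding m by (rule R_star_ge) (use k(1,3) carrier in \<open>simp_all del: length_butlast\<close>)
    then have m2: "m \<ge> 2" using n by linarith
    have "R_star M d \<phi> xs z n \<le> ((m ^ (k - 1) + 1) ^ D + 1) ^ m"
    proof (rule R_star_le[OF carrier])
      fix b assume b: "b \<in> nlists (length z) (carrier M)"
      have "arrows ?X (k - 1) (link (k - 1) (def_rel M d \<phi> xs z b) ?X y) (n - 1) m"
        if y: "y \<in> ?X" for y
      proof -
        have "y @ b \<in> nlists (length (last xs @ z)) (carrier M)"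
          using y b assms(5) xs by (auto simp: nlists_def)
        then show ?thesis
          using arrows_R_star[of "butlast xs" "y @ b" "last xs @ z" M d \<phi> "n - 1"]
            link_def_rel[OF xs y] k assms(4) m by simp
      qed
      then have "arrows ?X (Suc (k - 1)) (def_rel M d \<phi> xs z b) (Suc (n - 1))
          (((m ^ (k - 1) + 1) ^ D + 1) ^ m)"
        by (rule arrows_Suc[OF k(1) D[OF b]])
      then show "arrows ?X (length xs) (def_rel M d \<phi> xs z b) n
          (((m ^ (k - 1) + 1) ^ D + 1) ^ m)"
        using k n assms(4) by simp
    qed
    also have "\<dots> \<le> m ^ (e * m)"
      using step_up_bound_le_power[OF m2, of "k - 1" D] k unfolding e_def by simp
    finally have "real (R_star M d \<phi> xs z n) \<le> real m ^ (e * m)"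
      by (metis of_nat_le_iff of_nat_power)
    also have "\<dots> = (2 powr log 2 (real m)) powr real (e * m)"
      using m2 by (simp add: powr_realpow[symmetric])
    also have "\<dots> = 2 powr (real e * real m * log 2 (real m))"
      by (simp add: powr_powr mult_ac)
    finally show ?thesis .
  qed
  then show ?thesis
    unfolding Let_def eventually_sequentially by (intro exI[of _ "real e"] exI[of _ 3]) blast
qed

end
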